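(* For all integers $N,r\geq 0$ and every $f\in\mathrm{QSym}_N$, $$\Phi_{N+r}(h_r f)=\mathcal G_r\,\Phi_N(f).$$
   Context: Work over $\mathbb Q$. $\mathrm{QSym}_N$ is the degree-$N$ homogeneous component of the ring of quasisymmetric functions in commuting variables $z_1,z_2,\ldots$. For $N\geq1$ and $S\subseteq[N-1]=\{1,\ldots,N-1\}$ the fundamental quasisymmetric function is $$F_{N,S}=\sum_{\substack{1\leq i_1\leq\cdots\leq i_N\\ j\in S\Rightarrow i_j<i_{j+1}}} z_{i_1}\cdots z_{i_N},$$ and $F_{0,\varnothing}=1$; the $F_{N,S}$ form a basis of $\mathrm{QSym}_N$. The complete homogeneous symmetric function is $h_r=\sum_{1\leq i_1\leq\cdots\leq i_r}z_{i_1}\cdots z_{i_r}$, $h_0=1$. The linear map $\Phi_N:\mathrm{QSym}_N\to\mathbb Q[x,y]$ is defined by $\Phi_N(F_{N,S})=x^{|S|+1}y^{N-|S|}$, with $\Phi_0(1)=x$. With $D=\partial_x+\partial_y$, the operators $\mathcal G_r$ on $\mathbb Q[x,y]$ are $\mathcal G_0=\mathrm{id}$ and, for $r\geq1$, $\mathcal G_r=y^r\sum_{j=1}^{r}\binom{r-1}{j-1}\frac{x^j}{j!}D^j$. *)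

theory Defs
  imports "HOL-Library.Multiset" "HOL-Computational_Algebra.Polynomial"
begin

text \<open>
  Formal power series over the rationals in countably many commuting variables. A monomial is the
  finite multiset of its variables, so the product of monomials is multiset union and the degree
  is the size; a series is its coefficient function. Indices start at 0: the natural
  number \<open>i\<close> stands for the variable \<open>z\<^sub>i\<^sub>+\<^sub>1\<close>.
\<close>

type_synonym series = "nat multiset \<Rightarrow> rat"

definition series_mult :: "series \<Rightarrow> series \<Rightarrow> series"  (infixl "\<star>" 70) where
  "f \<star> g = (\<lambda>m. \<Sum>(a, b) | a + b = m. f a * g b)"

text \<open>The sum of the monomials \<open>z\<^bsub>i\<^sub>1\<^esub> \<cdots> z\<^bsub>i\<^sub>N\<^esub>\<close> over all index lists
  \<open>[i\<^sub>1, \<dots>, i\<^sub>N]\<close> in \<open>A\<close>. Each monomial arises from only finitely many lists.\<close>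

definition monomial_sum :: "nat list set \<Rightarrow> series" where
  "monomial_sum A = (\<lambda>m. of_nat (card {is \<in> A. mset is = m}))"

text \<open>List positions start at 0, so \<open>i\<^sub>j\<close> is \<open>is ! (j - 1)\<close>.\<close>

definition fundamental :: "nat \<Rightarrow> nat set \<Rightarrow> series" where
  "fundamental N S =
     monomial_sum {is. length is = N \<and> sorted is \<and> (\<forall>j\<in>S. is ! (j - 1) < is ! j)}"

definition complete_hom :: "nat \<Rightarrow> series" where
  "complete_hom r = monomial_sum {is. length is = r \<and> sorted is}"

text \<open>For exponents \<open>a\<^sub>1, \<dots>, a\<^sub>k \<ge> 1\<close>, the coefficient of
  \<open>z\<^bsub>i\<^sub>1\<^esub>\<^bsup>a\<^sub>1\<^esup> \<cdots> z\<^bsub>i\<^sub>k\<^esub>\<^bsup>a\<^sub>k\<^esup>\<close> is the same for all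
  \<open>i\<^sub>1 < \<cdots> < i\<^sub>k\<close>.\<close>

definition quasisymmetric :: "series \<Rightarrow> bool" where
  "quasisymmetric f \<longleftrightarrow>
     (\<forall>as is js. 0 \<notin> set as \<and> length is = length as \<and> length js = length as \<and>
        sorted_wrt (<) is \<and> sorted_wrt (<) js \<longrightarrow>
        f (\<Sum>(i, a)\<leftarrow>zip is as. replicate_mset a i) = f (\<Sum>(j, a)\<leftarrow>zip js as. replicate_mset a j))"

definition QSym :: "nat \<Rightarrow> series set" where
  "QSym N = {f. quasisymmetric f \<and> (\<forall>m. f m \<noteq> 0 \<longrightarrow> size m = N)}"

text \<open>The coordinates of an element of \<open>QSym N\<close> in the basis of the \<open>fundamental N S\<close>
  with \<open>S \<subseteq> {1..<N}\<close>, extended by 0 to all other sets \<open>S\<close>.\<close>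

definition fundamental_coeffs :: "nat \<Rightarrow> series \<Rightarrow> nat set \<Rightarrow> rat" where
  "fundamental_coeffs N f =
     (THE c. (\<forall>S. \<not> S \<subseteq> {1..<N} \<longrightarrow> c S = 0) \<and>
             (\<forall>m. f m = (\<Sum>S\<in>Pow {1..<N}. c S * fundamental N S m)))"

text \<open>The polynomial ring in \<open>x\<close> and \<open>y\<close> is taken as polynomials in \<open>y\<close> whose
  coefficients are polynomials in \<open>x\<close>.\<close>

type_synonym poly_xy = "rat poly poly"

definition X :: poly_xy where "X = [:[:0, 1:]:]"

definition Y :: poly_xy where "Y = [:0, 1:]"

definition scale :: "rat \<Rightarrow> poly_xy \<Rightarrow> poly_xy" where
  "scale c p = smult [:c:] p"

text \<open>The linear extension from the basis; for \<open>N = 0\<close> and \<open>S = {}\<close> the formula for the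
  basis values gives \<open>X\<close>, as required.\<close>

definition Phi :: "nat \<Rightarrow> series \<Rightarrow> poly_xy" where
  "Phi N f =
     (\<Sum>S\<in>Pow {1..<N}. scale (fundamental_coeffs N f S) (X ^ (card S + 1) * Y ^ (N - card S)))"

definition D :: "poly_xy \<Rightarrow> poly_xy" where
  "D p = map_poly pderiv p + pderiv p"

definition G :: "nat \<Rightarrow> poly_xy \<Rightarrow> poly_xy" where
  "G r p =
     (if r = 0 then p
      else Y ^ r * (\<Sum>j=1..r. scale (of_nat ((r - 1) choose (j - 1)) / fact j) (X ^ j * (D ^^ j) p)))"

end

theory Submission
  imports Defs
begin

text \<open>
  The polynomial \<open>Phi N f\<close> encodes the values \<open>f(1\<^sup>n)\<close> of \<open>f\<close> at \<open>n\<close> ones followed by zeros: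
  \<open>F\<^bsub>N,S\<^esub>(1\<^sup>n)\<close> is the coefficient of \<open>t\<^sup>n\<close> in \<open>t\<^bsup>|S|+1\<^esup> / (1 - t)\<^bsup>N+1\<^esup>\<close>, so that
  \<open>\<Phi>\<^sub>N(f)(t, 1) / (1 - t)\<^bsup>N+1\<^esup>\<close> is the generating function of these values for \<open>n \<ge> 1\<close>, and it
  determines the homogeneous polynomial \<open>\<Phi>\<^sub>N(f)\<close>. Multiplying \<open>f\<close> by \<open>h\<^sub>r\<close> multiplies the values
  by \<open>h\<^sub>r(1\<^sup>n) = binomial (n + r - 1) r\<close>. The operator \<open>G r\<close> does the same, by induction on \<open>r\<close>:
  \<open>(r + 1) G\<^bsub>r+1\<^esub> = (x y D + r (y - x)) G\<^sub>r\<close>, and \<open>x y D + r (y - x)\<close> acts on the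
  generating function as \<open>t d/dt + r\<close>, just as \<open>(r + 1) h\<^bsub>r+1\<^esub>(1\<^sup>n) = (n + r) h\<^sub>r(1\<^sup>n)\<close>.
\<close>

section \<open>The operators on polynomials\<close>

lemma scale_0 [simp]: "scale c 0 = 0" and scale_0_left [simp]: "scale 0 p = 0"
  and scale_1 [simp]: "scale 1 p = p"
  by (simp_all add: scale_def flip: one_pCons)

lemma scale_scale [simp]: "scale c (scale c' p) = scale (c * c') p"
  by (simp add: scale_def mult.commute)

lemma scale_add_right: "scale c (p + q) = scale c p + scale c q"
  and scale_add_left: "scale (c + c') p = scale c p + scale c' p"
  and scale_diff_right: "scale c (p - q) = scale c p - scale c q"
  and scale_diff_left: "scale (c - c') p = scale c p - scale c' p"
  and scale_minus_left: "scale (- c) p = - scale c p"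
  by (simp_all add: scale_def smult_add_right smult_diff_right flip: smult_add_left smult_diff_left smult_minus_left)

lemma mult_scale_left [simp]: "scale c p * q = scale c (p * q)"
  and mult_scale_right [simp]: "p * scale c q = scale c (p * q)"
  by (simp_all add: scale_def)

lemma scale_sum: "scale c (sum p A) = (\<Sum>a\<in>A. scale c (p a))"
  by (induction A rule: infinite_finite_induct) (simp_all add: scale_add_right)

lemma of_nat_mult_eq_scale: "of_nat n * p = scale (of_nat n) p"
  by (induction n) (simp_all add: scale_add_left distrib_right)

section \<open>The derivation \<open>D\<close>\<close>

lemma D_add: "D (p + q) = D p + D q"
proof -
  have "map_poly pderiv (p + q) = map_poly pderiv p + map_poly pderiv q"
    by (rule poly_eqI) (simp add: coeff_map_poly pderiv_add)
  then show ?thesis by (simp add: D_def pderiv_add)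
qed

lemma D_0 [simp]: "D 0 = 0"
  by (simp add: D_def)

text \<open>\<open>map_poly pderiv\<close> and the outer \<open>pderiv\<close> are the partial
  derivatives in x and y. Each obeys the product rule, the first by comparing coefficients of powers
  of y.\<close>

lemma D_mult: "D (p * q) = D p * q + p * D q"
proof -
  have "map_poly pderiv (p * q) = map_poly pderiv p * q + p * map_poly pderiv q"
  proof (rule poly_eqI)
    have "pderiv (sum u A) = (\<Sum>i\<in>A. pderiv (u i))" for u :: "nat \<Rightarrow> rat poly" and A
      by (induction A rule: infinite_finite_induct) (simp_all add: pderiv_add)
    then show "coeff (map_poly pderiv (p * q)) n =
        coeff (map_poly pderiv p * q + p * map_poly pderiv q) n" for n
      by (simp add: coeff_map_poly coeff_mult pderiv_mult sum.distrib add.commute mult.commute [of "coeff q _"])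
  qed
  then show ?thesis by (simp add: D_def pderiv_mult algebra_simps)
qed

lemma D_scale: "D (scale c p) = scale c (D p)"
proof -
  have "scale c p = [:[:c:]:] * p" by (simp add: scale_def)
  moreover have "D [:[:c:]:] = 0" by (simp add: D_def map_poly_pCons pderiv_pCons)
  ultimately show ?thesis by (simp only: D_mult) (simp add: scale_def)
qed

lemma D_X: "D X = 1" and D_Y: "D Y = 1" and D_1: "D 1 = 0"
  by (simp_all add: D_def X_def Y_def map_poly_pCons pderiv_pCons one_pCons)

text \<open>The extra factor \<open>p\<close> keeps the exponent \<open>n\<close> instead of
  \<open>n - 1\<close>, so that \<open>n = 0\<close> is no exception.\<close>

lemma mult_D_power: "p * D (p ^ n) = scale (of_nat n) (p ^ n * D p)"
proof (induction n)
  case (Suc n)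
  have "p * D (p ^ Suc n) = p ^ Suc n * D p + p * (p * D (p ^ n))"
    by (simp add: D_mult algebra_simps)
  then show ?case
    by (simp add: Suc scale_add_left algebra_simps)
qed (simp add: D_1)

text \<open>For p homogeneous of degree d, Euler's identity turns t d/dt of p(t, 1) / (1 - t)^d into
  \<open>X * Y * D p\<close> over (1 - t)^(d + 1). The factor \<open>Y - X\<close> becomes 1 - t, so
  the second term stands for multiplication by r.\<close>

definition raise_op :: "nat \<Rightarrow> poly_xy \<Rightarrow> poly_xy" where
  "raise_op r p = X * Y * D p + scale (of_nat r) ((Y - X) * p)"

text \<open>Setting j = i + 1 removes the differences \<open>r - 1\<close> and
  \<open>j - 1\<close>.\<close>

lemma G_Suc_eq: "G (Suc n) p =
    (\<Sum>i\<le>n. scale (of_nat (n choose i) / fact (Suc i)) (Y ^ Suc n * X ^ Suc i * (D ^^ Suc i) p))"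
proof -
  have "G (Suc n) p = Y ^ Suc n * (\<Sum>j=Suc 0..Suc n. scale (of_nat (n choose (j - 1)) / fact j) (X ^ j * (D ^^ j) p))"
    by (simp add: G_def)
  also have "\<dots> = Y ^ Suc n * (\<Sum>i=0..n. scale (of_nat (n choose i) / fact (Suc i)) (X ^ Suc i * (D ^^ Suc i) p))"
    by (subst sum.shift_bounds_cl_Suc_ivl) simp
  finally show ?thesis by (simp add: sum_distrib_left atMost_atLeast0 mult.assoc)
qed

lemma raise_op_0 [simp]: "raise_op r 0 = 0"
  and raise_op_add: "raise_op r (p + q) = raise_op r p + raise_op r q"
  and raise_op_scale: "raise_op r (scale c p) = scale c (raise_op r p)"
  by (simp_all add: raise_op_def D_add D_scale scale_add_right scale_diff_right algebra_simps)

lemma raise_op_sum: "raise_op r (sum p A) = (\<Sum>a\<in>A. raise_op r (p a))"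
  by (induction A rule: infinite_finite_induct) (simp_all add: raise_op_add)

text \<open>Since \<open>D\<close> is a derivation, the term of order zero can be charged to
  \<open>p\<close> alone; below, \<open>p\<close> is a monomial and \<open>q\<close> an iterated
  derivative.\<close>

lemma raise_op_mult:
  "raise_op r (p * q) = raise_op r p * q + X * Y * p * D q"
  by (simp add: raise_op_def D_mult algebra_simps)

lemma raise_op_monomial: "raise_op r (X ^ a * Y ^ b) =
    scale (of_nat a + of_nat r) (X ^ a * Y ^ Suc b) + scale (of_nat b - of_nat r) (X ^ Suc a * Y ^ b)"
proof -
  have "X * Y * D (X ^ a * Y ^ b) = (X * D (X ^ a)) * Y ^ Suc b + X ^ Suc a * (Y * D (Y ^ b))"
    by (simp add: D_mult algebra_simps)
  also have "\<dots> = scale (of_nat a) (X ^ a * Y ^ Suc b) + scale (of_nat b) (X ^ Suc a * Y ^ b)"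
    by (simp add: mult_D_power D_X D_Y)
  finally show ?thesis
    by (simp add: raise_op_def scale_add_left scale_diff_left scale_diff_right algebra_simps)
qed

text \<open>For positive r, the operator sends term i of \<open>G r p\<close> to a combination of
  terms i and i + 1 of \<open>G (Suc r) p\<close>; the rest is a comparison of binomial
  coefficients.\<close>

lemma raise_op_G: "raise_op r (G r p) = of_nat (Suc r) * G (Suc r) p"
proof (cases r)
  case 0
  then show ?thesis by (simp add: raise_op_def G_def)
next
  case (Suc n)
  \<comment> \<open>The building blocks of \<open>G (Suc r) p\<close>, in which
    \<open>s (Suc i)\<close> has coefficient \<open>r choose i\<close>.\<close>
  define s where "s i = scale (1 / fact i) (X ^ i * Y ^ Suc r * (D ^^ i) p)" for i
  have raise_term: "raise_op r (scale (of_nat (n choose i) / fact (Suc i)) (Y ^ Suc n * X ^ Suc i * (D ^^ Suc i) p))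
     = scale (of_nat ((n choose i) * (i + n + 2))) (s (Suc i))
       + scale (of_nat ((n choose i) * (i + 2))) (s (Suc (Suc i)))" for i
  proof -
    \<comment> \<open>The exponent \<open>Suc n\<close> of \<open>Y\<close> equals r, so the second
      term of \<open>raise_op_monomial\<close> vanishes.\<close>
    have "raise_op r (X ^ Suc i * Y ^ Suc n * (D ^^ Suc i) p) =
        scale (of_nat (i + n + 2)) (X ^ Suc i * Y ^ Suc r * (D ^^ Suc i) p)
        + X ^ Suc (Suc i) * Y ^ Suc r * (D ^^ Suc (Suc i)) p"
      unfolding raise_op_mult [of r "X ^ Suc i * Y ^ Suc n"] raise_op_monomial by (simp add: Suc add_ac mult_ac)
    moreover have "of_nat ((n choose i) * (i + 2)) * (1 / fact (Suc (Suc i))) = (of_nat (n choose i) / fact (Suc i) :: rat)"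
      by (subst fact_Suc [of "Suc i"]) (simp del: fact_Suc of_nat_Suc of_nat_add mult_Suc_right)
    moreover have "of_nat ((n choose i) * (i + n + 2)) * (1 / fact (Suc i)) =
        (of_nat (n choose i) / fact (Suc i) * of_nat (i + n + 2) :: rat)"
      by (simp add: add_divide_distrib algebra_simps del: fact_Suc)
    ultimately show ?thesis
      by (simp only: mult.commute [of "Y ^ Suc n"] raise_op_scale s_def scale_scale scale_add_right)
  qed
  \<comment> \<open>This compares the coefficients of \<open>s (Suc (Suc i))\<close>. Pascal's rule
    reduces it to (i + 1) C(n, i + 1) = (n - i) C(n, i).\<close>
  have choose: "(n + 2) * (Suc n choose Suc i) = (n choose Suc i) * (Suc i + n + 2) + (n choose i) * (i + 2)" for i
  proof -
    have "(n - i) * (n choose i) + i * (n choose i) = n * (n choose i)"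
      by (cases "i \<le> n") (simp_all add: binomial_eq_0 flip: distrib_right)
    moreover have "Suc i * (n choose Suc i) = (n - i) * (n choose i)"
      using binomial_absorb_comp [of n i] binomial_absorption [of i n] by simp
    ultimately have "Suc i * (n choose Suc i) + i * (n choose i) = n * (n choose i)"
      by simp
    then show ?thesis by (simp add: algebra_simps)
  qed
  \<comment> \<open>The first sum is extended to \<open>Suc n\<close> by a zero term, so that
    splitting off i = 0 aligns it with the second.\<close>
  have "raise_op r (G r p) = (\<Sum>i\<le>Suc n. scale (of_nat ((n choose i) * (i + n + 2))) (s (Suc i)))
       + (\<Sum>i\<le>n. scale (of_nat ((n choose i) * (i + 2))) (s (Suc (Suc i))))"
    unfolding Suc G_Suc_eq raise_op_sum raise_term[unfolded Suc]
    by (simp add: sum.distrib binomial_eq_0)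
  also have "\<dots> = (\<Sum>i\<le>Suc n. scale (of_nat ((n + 2) * (Suc n choose i))) (s (Suc i)))"
    unfolding sum.atMost_Suc_shift choose of_nat_add scale_add_left sum.distrib by simp
  also have "\<dots> = of_nat (Suc r) * G (Suc r) p"
    unfolding G_Suc_eq of_nat_mult_eq_scale scale_sum s_def
    by (simp add: Suc add_divide_distrib algebra_simps del: power_Suc fact_Suc binomial_Suc_Suc funpow.simps sum.atMost_Suc)
  finally show ?thesis .
qed

section \<open>Homogeneous polynomials as generating functions\<close>

text \<open>
  With \<open>n = k + 1\<close>, \<open>\<phi> k\<close> is the coefficient of \<open>t\<^sup>n\<close> in \<open>p(t, 1) / (1 - t)\<^sup>d\<close>,
  for \<open>p\<close> homogeneous of degree \<open>d\<close> and divisible by \<open>x\<close>.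
\<close>

definition represents :: "nat \<Rightarrow> (nat \<Rightarrow> rat) \<Rightarrow> poly_xy \<Rightarrow> bool" where
  "represents d \<phi> p \<longleftrightarrow> (\<exists>q. p = (\<Sum>a=1..d. scale (q a) (X ^ a * Y ^ (d - a))) \<and>
     (\<forall>k. \<phi> k = (\<Sum>a=1..d. q a * of_nat ((k + d - a) choose (d - 1)))))"

lemma represents_0 [simp]: "represents d (\<lambda>_. 0) 0"
  unfolding represents_def by (rule exI[of _ "\<lambda>_. 0"]) simp

lemma represents_add:
  assumes "represents d \<phi> p" "represents d \<psi> q"
  shows "represents d (\<lambda>k. \<phi> k + \<psi> k) (p + q)"
proof -
  obtain a b where "p = (\<Sum>i=1..d. scale (a i) (X ^ i * Y ^ (d - i)))"
    "\<forall>k. \<phi> k = (\<Sum>i=1..d. a i * of_nat ((k + d - i) choose (d - 1)))"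
    "q = (\<Sum>i=1..d. scale (b i) (X ^ i * Y ^ (d - i)))"
    "\<forall>k. \<psi> k = (\<Sum>i=1..d. b i * of_nat ((k + d - i) choose (d - 1)))"
    using assms unfolding represents_def by blast
  then show ?thesis
    unfolding represents_def
    by (intro exI[of _ "\<lambda>i. a i + b i"]) (simp add: scale_add_left sum.distrib distrib_right)
qed

lemma represents_scale:
  assumes "represents d \<phi> p"
  shows "represents d (\<lambda>k. c * \<phi> k) (scale c p)"
proof -
  obtain a where "p = (\<Sum>i=1..d. scale (a i) (X ^ i * Y ^ (d - i)))"
    "\<forall>k. \<phi> k = (\<Sum>i=1..d. a i * of_nat ((k + d - i) choose (d - 1)))"
    using assms unfolding represents_def by blast
  then show ?thesis
    unfolding represents_def
    by (intro exI[of _ "\<lambda>i. c * a i"]) (simp add: scale_sum sum_distrib_left mult.assoc)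
qed

lemma represents_sum:
  assumes "\<And>i. i \<in> A \<Longrightarrow> represents d (\<phi> i) (p i)"
  shows "represents d (\<lambda>k. \<Sum>i\<in>A. \<phi> i k) (\<Sum>i\<in>A. p i)"
  using assms by (induction A rule: infinite_finite_induct) (simp_all add: represents_add)

text \<open>The binomial is the coefficient of t^(k + 1) in t^a / (1 - t)^d. As a \<le> d, the
  subtraction does not truncate, and the value is 0 while k + 1 < a.\<close>

lemma represents_monomial:
  assumes "a \<in> {1..d}"
  shows "represents d (\<lambda>k. of_nat ((k + d - a) choose (d - 1))) (X ^ a * Y ^ (d - a))"
  unfolding represents_def
proof (intro exI[of _ "\<lambda>i. if i = a then 1 else 0"] conjI allI)
  show "X ^ a * Y ^ (d - a) = (\<Sum>i=1..d. scale (if i = a then 1 else 0) (X ^ i * Y ^ (d - i)))"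
    using assms by (subst sum.remove[of _ a]) auto
qed (use assms in \<open>simp add: if_distrib [of "\<lambda>c. c * _"] cong: if_cong\<close>)

text \<open>The binomial matrix is unitriangular: at k = a - 1 the entry of index a is 1 and those
  of larger index vanish, so the coefficients of the difference are zero one after another.\<close>

lemma represents_unique:
  assumes "represents d \<phi> p" "represents d \<phi> p'"
  shows "p = p'"
proof -
  have "represents d (\<lambda>k. \<phi> k + - 1 * \<phi> k) (p + scale (- 1) p')"
    by (intro represents_add represents_scale assms)
  then obtain q where q: "p + scale (- 1) p' = (\<Sum>a=1..d. scale (q a) (X ^ a * Y ^ (d - a)))"
    and 0: "(\<Sum>a=1..d. q a * of_nat ((k + d - a) choose (d - 1))) = 0" for k
    unfolding represents_def by auto
  have "q a = 0" if "a \<in> {1..d}" for a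
    using that
  proof (induction a rule: less_induct)
    case (less a)
    have "0 = (\<Sum>i=1..d. q i * of_nat ((a - 1 + d - i) choose (d - 1)))"
      by (simp only: 0)
    also have "\<dots> = (\<Sum>i=1..d. if i = a then q a else 0)"
    proof (rule sum.cong[OF refl])
      fix i assume i: "i \<in> {1..d}"
      consider "i < a" | "i = a" | "i > a" by linarith
      then show "q i * of_nat ((a - 1 + d - i) choose (d - 1)) = (if i = a then q a else 0)"
      proof cases
        case 1
        then show ?thesis using less i by simp
      next
        case 2
        then have "a - 1 + d - i = d - 1" using i by auto
        then show ?thesis using 2 by simp
      next
        case 3
        then have "a - 1 + d - i < d - 1" using i less.prems by auto
        then show ?thesis using 3 by (simp add: binomial_eq_0)
      qed
    qed
    finally show ?case using less.prems by simp
  qed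
  then have "p + scale (- 1) p' = 0" by (simp add: q)
  then show ?thesis by (simp add: scale_minus_left)
qed

text \<open>After Pascal's rule r stays only with \<open>(k + b) choose d\<close>, and (d + 1) C(k +
  b, d + 1) = (k + b - d) C(k + b, d) finishes. This is \<open>raise_op_monomial\<close> read off on
  values.\<close>

lemma binomial_raise_op:
  assumes "a + b = Suc d"
  shows "(of_nat a + of_nat r) * of_nat (Suc (k + b) choose Suc d)
       + (of_nat b - of_nat r) * of_nat ((k + b) choose Suc d)
     = (of_nat (Suc k + r) * of_nat ((k + b) choose d) :: rat)"
proof -
  have "Suc d * ((k + b) choose Suc d) = (k + b - d) * ((k + b) choose d)"
    using binomial_absorb_comp[of "k + b" d] binomial_absorption[of d "k+b"] by simp
  then have *: "of_nat (Suc d) * of_nat ((k + b) choose Suc d) =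
    (of_nat (k + b) - of_nat d :: rat) * of_nat ((k + b) choose d)"
    by (cases "d \<le> k + b") (simp_all only: of_nat_mult [symmetric] of_nat_diff [symmetric], simp_all add: binomial_eq_0)
  have "rat_of_nat a + of_nat b = of_nat d + 1"
    using arg_cong[OF assms, of rat_of_nat] by simp
  then have a: "rat_of_nat a = of_nat d + 1 - of_nat b" by simp
  show ?thesis using * unfolding a by (simp add: algebra_simps)
qed

lemma represents_raise:
  assumes "represents d \<phi> p"
  shows "represents (Suc d) (\<lambda>k. of_nat (Suc k + r) * \<phi> k) (raise_op r p)"
proof -
  obtain q where p: "p = (\<Sum>a=1..d. scale (q a) (X ^ a * Y ^ (d - a)))"
    and \<phi>: "\<And>k. \<phi> k = (\<Sum>a=1..d. q a * of_nat ((k + d - a) choose (d - 1)))"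
    using assms unfolding represents_def by blast
  have "represents (Suc d) (\<lambda>k. of_nat (Suc k + r) * of_nat ((k + d - a) choose (d - 1)))
      (raise_op r (X ^ a * Y ^ (d - a)))" if a: "a \<in> {1..d}" for a
  proof -
    \<comment> \<open>A monomial with positive a forces d > 0, so \<open>d - 1\<close> is a true
      predecessor.\<close>
    obtain d' where d': "d = Suc d'" using a by (cases d) auto
    have *: "represents (Suc d) (\<lambda>k. (of_nat a + of_nat r) * of_nat ((k + Suc d - a) choose (Suc d - 1))
        + (of_nat (d - a) - of_nat r) * of_nat ((k + Suc d - Suc a) choose (Suc d - 1)))
        (scale (of_nat a + of_nat r) (X ^ a * Y ^ (Suc d - a))
        + scale (of_nat (d - a) - of_nat r) (X ^ Suc a * Y ^ (Suc d - Suc a)))"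
      using a by (intro represents_add represents_scale represents_monomial) auto
    have e: "k + Suc d - a = Suc (k + (d - a))" "k + Suc d - Suc a = k + (d - a)" "k + d - a = k + (d - a)"
      "Suc d - a = Suc (d - a)" for k
      using a by auto
    show ?thesis
      using * binomial_raise_op[of a "d - a" d' r] a d' unfolding raise_op_monomial e by simp
  qed
  then have "represents (Suc d) (\<lambda>k. \<Sum>a=1..d. q a * (of_nat (Suc k + r) * of_nat ((k + d - a) choose (d - 1))))
     (\<Sum>a=1..d. scale (q a) (raise_op r (X ^ a * Y ^ (d - a))))"
    by (intro represents_sum represents_scale) 
  then show ?thesis
    by (simp add: p \<phi> raise_op_sum raise_op_scale sum_distrib_left mult.left_commute)
qed

text \<open>The factor \<open>(k + r) choose r\<close> is h_r at k + 1 ones. The induction divides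
  \<open>raise_op_G\<close> by r + 1.\<close>

lemma represents_G:
  assumes "represents d \<phi> p"
  shows "represents (d + r) (\<lambda>k. of_nat ((k + r) choose r) * \<phi> k) (G r p)"
proof (induction r)
  case 0
  then show ?case using assms by (simp add: G_def)
next
  case (Suc r)
  have "scale (1 / of_nat (Suc r)) (raise_op r (G r p)) = G (Suc r) p"
    by (simp add: raise_op_G of_nat_mult_eq_scale del: of_nat_Suc)
  moreover have "1 / of_nat (Suc r) * (of_nat (Suc k + r) * (of_nat ((k + r) choose r) * \<phi> k))
    = of_nat ((k + Suc r) choose Suc r) * \<phi> k" for k
  proof -
    have "Suc r * ((k + Suc r) choose Suc r) = (Suc k + r) * ((k + r) choose r)"
      using Suc_times_binomial[of r "k + r"] by simp
    then have "rat_of_nat (Suc r) * of_nat ((k + Suc r) choose Suc r) = of_nat (Suc k + r) * of_nat ((k + r) choose r)"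
      by (simp only: of_nat_mult [symmetric])
    then show ?thesis by (simp add: field_simps)
  qed
  ultimately show ?case
    using represents_scale[OF represents_raise[OF Suc, of r], of "1 / of_nat (Suc r)"] by simp
qed

section \<open>Quasisymmetric functions and the fundamental basis\<close>

text \<open>A reformulation of quasisymmetry that is visibly preserved by products.\<close>

definition shift_invariant :: "series \<Rightarrow> bool" where
  "shift_invariant f \<longleftrightarrow> (\<forall>m \<phi>. strict_mono_on (set_mset m) \<phi> \<longrightarrow> f (image_mset \<phi> m) = f m)"

lemma shift_invariantD:
  "shift_invariant f \<Longrightarrow> strict_mono_on (set_mset m) \<phi> \<Longrightarrow> f (image_mset \<phi> m) = f m"
  by (simp add: shift_invariant_def)

text \<open>Translates the exponent lists of \<open>quasisymmetric\<close> into image multisets. The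
  induction removes all copies of the first variable at once.\<close>

lemma sum_list_zip_replicate_mset:
  assumes "distinct xs" "set xs = set_mset m"
  shows "(\<Sum>(i, a)\<leftarrow>zip (map \<phi> xs) (map (count m) xs). replicate_mset a i) = image_mset \<phi> m"
  using assms
proof (induction xs arbitrary: m)
  case Nil
  then show ?case by (simp add: eq_commute [of "{}"])
next
  case (Cons x xs)
  define m' where "m' = filter_mset (\<lambda>y. y \<noteq> x) m"
  have m: "m = replicate_mset (count m x) x + m'"
    unfolding m'_def by (rule multiset_eqI) auto
  have "map (count m) xs = map (count m') xs"
    using Cons.prems by (auto simp: m'_def)
  moreover have "set xs = set_mset m'"
    using Cons.prems by (auto simp: m'_def)
  then have "(\<Sum>(i, a)\<leftarrow>zip (map \<phi> xs) (map (count m') xs). replicate_mset a i) = image_mset \<phi> m'"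
    using Cons.prems by (intro Cons.IH) simp_all
  ultimately have "(\<Sum>(i, a)\<leftarrow>zip (map \<phi> (x # xs)) (map (count m) (x # xs)). replicate_mset a i)
      = replicate_mset (count m x) (\<phi> x) + image_mset \<phi> m'"
    by (simp del: map_eq_conv)
  also have "\<dots> = image_mset \<phi> m"
    by (subst (2) m) simp
  finally show ?case .
qed

text \<open>Quasisymmetry is applied to the increasing list of the variables of m and to its image
  under \<phi>, with the multiplicities as common exponents.\<close>

lemma quasisymmetric_imp_shift_invariant:
  assumes "quasisymmetric f"
  shows "shift_invariant f"
  unfolding shift_invariant_def
proof (intro allI impI)
  fix m :: "nat multiset" and \<phi> :: "nat \<Rightarrow> nat"
  assume \<phi>: "strict_mono_on (set_mset m) \<phi>"
  define xs where "xs = sorted_list_of_set (set_mset m)"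
  have xs: "sorted_wrt (<) xs" "set xs = set_mset m" "distinct xs"
    by (simp_all add: xs_def)
  have "sorted_wrt (<) (map \<phi> xs)"
    unfolding sorted_wrt_map
    by (rule sorted_wrt_mono_rel[OF _ xs(1)]) (use \<phi> xs(2) in \<open>auto simp: strict_mono_on_def\<close>)
  moreover have "0 \<notin> set (map (count m) xs)"
    using xs(2) by (auto simp: count_eq_zero_iff)
  ultimately have "f (\<Sum>(i, a)\<leftarrow>zip (map \<phi> xs) (map (count m) xs). replicate_mset a i)
      = f (\<Sum>(i, a)\<leftarrow>zip (map id xs) (map (count m) xs). replicate_mset a i)"
    using assms xs(1) unfolding quasisymmetric_def by (metis length_map list.map_id)
  then show "f (image_mset \<phi> m) = f m"
    using xs by (simp only: sum_list_zip_replicate_mset) simp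
qed

text \<open>As \<phi> is injective on the variables of m, it carries the factorizations of m
  bijectively to those of its image, and it is strictly increasing on the variables of each
  factor.\<close>

lemma shift_invariant_series_mult:
  assumes f: "shift_invariant f" and g: "shift_invariant g"
  shows "shift_invariant (f \<star> g)"
  unfolding shift_invariant_def
proof (intro allI impI)
  fix m :: "nat multiset" and \<phi> :: "nat \<Rightarrow> nat"
  assume \<phi>: "strict_mono_on (set_mset m) \<phi>"
  have inj: "inj_on \<phi> (set_mset m)"
    by (rule strict_mono_on_imp_inj_on[OF \<phi>])
  define \<psi> where "\<psi> = the_inv_into (set_mset m) \<phi>"
  have \<psi>: "\<psi> (\<phi> x) = x" if "x \<in># m" for x
    unfolding \<psi>_def using inj that by (rule the_inv_into_f_f)
  have \<psi>': "\<phi> (\<psi> x) = x" if "x \<in> \<phi> ` set_mset m" for x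
    using that \<psi> by auto
  have "(\<Sum>(a, b) | a + b = image_mset \<phi> m. f a * g b) = (\<Sum>(a, b) | a + b = m. f a * g b)"
  \<comment> \<open>The five goals in order: i after j is the identity, j lands in the
    factorizations of m, j after i is the identity, i lands in those of the image, and the summands
    agree.\<close>
  proof (rule sum.reindex_bij_witness[where j = "map_prod (image_mset \<psi>) (image_mset \<psi>)"
        and i = "map_prod (image_mset \<phi>) (image_mset \<phi>)"], goal_cases)
    case (1 p)
    then obtain a b where p: "p = (a, b)" "a + b = image_mset \<phi> m" by (cases p) auto
    then have "set_mset (a + b) = \<phi> ` set_mset m" by simp
    then have "set_mset a \<subseteq> \<phi> ` set_mset m" "set_mset b \<subseteq> \<phi> ` set_mset m" by auto
    then have "image_mset (\<phi> \<circ> \<psi>) a = a" "image_mset (\<phi> \<circ> \<psi>) b = b"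
      using \<psi>' by (auto simp: subset_iff intro!: multiset.map_ident_strong)
    then show ?case by (simp add: p multiset.map_comp)
  next
    case (2 p)
    then obtain a b where p: "p = (a, b)" "a + b = image_mset \<phi> m" by (cases p) auto
    have "image_mset \<psi> (a + b) = image_mset (\<psi> \<circ> \<phi>) m"
      by (simp add: p(2) multiset.map_comp)
    also have "\<dots> = image_mset id m"
      using \<psi> by (intro image_mset_cong) auto
    finally show ?case by (simp add: p(1))
  next
    case (3 p)
    then obtain a b where p: "p = (a, b)" "a + b = m" by (cases p) auto
    then have "set_mset a \<subseteq> set_mset m" "set_mset b \<subseteq> set_mset m" by auto
    then have "image_mset (\<psi> \<circ> \<phi>) a = a" "image_mset (\<psi> \<circ> \<phi>) b = b"
      using \<psi> by (auto simp: subset_iff intro!: multiset.map_ident_strong)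
    then show ?case by (simp add: p multiset.map_comp)
  next
    case (4 p)
    then show ?case by (auto simp flip: image_mset_union)
  next
    case (5 p)
    then obtain a b where p: "p = (a, b)" "a + b = image_mset \<phi> m" by (cases p) auto
    obtain a' b' where ab: "m = a' + b'" "a = image_mset \<phi> a'" "b = image_mset \<phi> b'"
      using image_mset_eq_plusD[of \<phi> m a b] p(2) by metis
    have "strict_mono_on (set_mset a') \<phi>" "strict_mono_on (set_mset b') \<phi>"
      using \<phi> ab(1) by (auto simp: strict_mono_on_def)
    then have "f a = f a'" "g b = g b'"
      using f g ab by (simp_all add: shift_invariantD)
    moreover have "image_mset (\<psi> \<circ> \<phi>) a' = a'" "image_mset (\<psi> \<circ> \<phi>) b' = b'"
      using \<psi> ab(1) by (auto intro!: multiset.map_ident_strong)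
    ultimately show ?case by (simp add: p ab multiset.map_comp)
  qed
  then show "(f \<star> g) (image_mset \<phi> m) = (f \<star> g) m"
    by (simp add: series_mult_def)
qed

lemma series_mult_apply: "(f \<star> g) m = (\<Sum>p | fst p + snd p = m. f (fst p) * g (snd p))"
proof -
  have "{(a, b). a + b = m} = {p. fst p + snd p = m}" by auto
  then show ?thesis by (simp add: series_mult_def case_prod_beta)
qed

section \<open>Monomials as sorted lists, and their ascent sets\<close>

lemma monomial_sum_sorted:
  assumes "\<And>is. is \<in> A \<Longrightarrow> sorted is"
  shows "monomial_sum A m = (if sorted_list_of_multiset m \<in> A then 1 else 0)"
proof -
  \<comment> \<open>A monomial has a single sorted index list, so the coefficient is 0 or 1.\<close>
  have "mset is = m \<longleftrightarrow> is = sorted_list_of_multiset m" if "is \<in> A" for "is"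
    using assms[OF that] by (metis mset_sorted_list_of_multiset sorted_list_of_multiset_mset sorted_sort_id)
  then have "{is \<in> A. mset is = m} = {is \<in> A. is = sorted_list_of_multiset m}"
    by (simp cong: conj_cong)
  also have "\<dots> = (if sorted_list_of_multiset m \<in> A then {sorted_list_of_multiset m} else {})"
    by auto
  finally show ?thesis by (simp add: monomial_sum_def)
qed

text \<open>These are the proper partial sums of the exponents of m in the order of the variables:
  the subset of [N - 1] that encodes a composition of N.\<close>

definition ascents :: "nat multiset \<Rightarrow> nat set" where
  "ascents m = {j \<in> {1..<size m}. sorted_list_of_multiset m ! (j - 1) < sorted_list_of_multiset m ! j}"

lemma length_sorted_list_of_multiset [simp]: "length (sorted_list_of_multiset m) = size m"
  by (metis mset_sorted_list_of_multiset size_mset)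

lemma fundamental_eq:
  assumes "S \<subseteq> {1..<N}"
  shows "fundamental N S m = (if size m = N \<and> S \<subseteq> ascents m then 1 else 0)"
  using assms unfolding fundamental_def
  by (subst monomial_sum_sorted) (auto simp: ascents_def)

lemma complete_hom_eq_fundamental: "complete_hom r = fundamental r {}"
  by (simp add: complete_hom_def fundamental_def)

lemma complete_hom_eq: "complete_hom r m = (if size m = r then 1 else 0)"
  by (simp add: complete_hom_eq_fundamental fundamental_eq)

lemma shift_invariant_complete_hom: "shift_invariant (complete_hom r)"
  by (simp add: shift_invariant_def complete_hom_eq)

text \<open>Makes every comparison of two entries a function of the ascent set.\<close>

lemma sorted_nth_less_iff:
  assumes "i \<le> j" "j < size m"
  shows "sorted_list_of_multiset m ! i < sorted_list_of_multiset m ! j \<longleftrightarrow> ascents m \<inter> {i<..j} \<noteq> {}"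
  using assms
proof (induction j rule: dec_induct)
  case base
  then show ?case by simp
next
  case (step j)
  let ?l = "sorted_list_of_multiset m"
  have "{i<..Suc j} = insert (Suc j) {i<..j}" using step by auto
  moreover have "Suc j \<in> ascents m \<longleftrightarrow> ?l ! j < ?l ! Suc j"
    using step.prems by (simp add: ascents_def)
  moreover have "?l ! j \<le> ?l ! Suc j" "?l ! i \<le> ?l ! j"
    using step by (simp_all add: sorted_nth_mono)
  ultimately show ?case using step by auto
qed

text \<open>The two sorted lists have the same comparisons between positions, so matching them
  position by position gives a well-defined, strictly increasing map of variables.\<close>

lemma ascents_eq_imp_image:
  assumes "size m = size m'" "ascents m = ascents m'"
  obtains \<phi> where "strict_mono_on (set_mset m) \<phi>" "m' = image_mset \<phi> m"
proof -
  define l where "l = sorted_list_of_multiset m"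
  define l' where "l' = sorted_list_of_multiset m'"
  have len: "length l = size m" "length l' = size m" by (simp_all add: l_def l'_def assms)
  have less: "l ! i < l ! j \<longleftrightarrow> l' ! i < l' ! j" if "i < size m" "j < size m" for i j
  proof (cases "i \<le> j")
    case True
    then show ?thesis unfolding l_def l'_def using that assms by (simp add: sorted_nth_less_iff)
  next
    case False
    then have "l ! j \<le> l ! i" "l' ! j \<le> l' ! i"
      using that len by (simp_all add: l_def l'_def sorted_nth_mono)
    then show ?thesis by simp
  qed
  \<comment> \<open>Any position of v may be chosen: positions with equal entries in
    \<open>l\<close> have equal entries in \<open>l'\<close>.\<close>
  define \<phi> where "\<phi> v = l' ! (SOME i. i < size m \<and> l ! i = v)" for v
  have \<phi>: "\<phi> (l ! i) = l' ! i" if "i < size m" for i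
  proof -
    define k where "k = (SOME k. k < size m \<and> l ! k = l ! i)"
    have "k < size m \<and> l ! k = l ! i"
      unfolding k_def using that by (intro someI[of "\<lambda>k. k < size m \<and> l ! k = l ! i" i]) simp
    then have "l' ! k = l' ! i"
      using less[of k i] less[of i k] that by simp
    then show ?thesis by (simp add: \<phi>_def k_def)
  qed
  have "map \<phi> l = l'"
    by (rule nth_equalityI) (simp_all add: len \<phi>)
  then have "m' = image_mset \<phi> m"
    by (metis l_def l'_def mset_map mset_sorted_list_of_multiset)
  moreover have "strict_mono_on (set_mset m) \<phi>"
  proof (rule strict_mono_onI)
    fix u v assume "u \<in> set_mset m" "v \<in> set_mset m" "u < v"
    moreover have "set_mset m = set l" by (simp add: l_def)
    ultimately obtain i j where "i < size m" "j < size m" "u = l ! i" "v = l ! j"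
      by (metis in_set_conv_nth len(1))
    then show "\<phi> u < \<phi> v" using \<open>u < v\<close> less \<phi> by simp
  qed
  ultimately show thesis using that by blast
qed

lemma exists_ascents_eq:
  assumes "T \<subseteq> {1..<N}"
  obtains m where "size m = N" "ascents m = T"
proof -
  \<comment> \<open>Entry i counts the elements of T up to i, so the list rises exactly at the
    positions in T.\<close>
  define l where "l = map (\<lambda>i. card (T \<inter> {..i})) [0..<N]"
  have "finite T" using assms finite_subset by blast
  have "sorted l"
    unfolding l_def sorted_map by (rule sorted_wrt_mono_rel[OF _ sorted_upt]) (use \<open>finite T\<close> in \<open>auto intro!: card_mono\<close>)
  then have l: "sorted_list_of_multiset (mset l) = l" by (simp add: sorted_sort_id)
  have "l ! (j - 1) < l ! j \<longleftrightarrow> j \<in> T" if "j \<in> {1..<N}" for j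
  proof -
    obtain i where j: "j = Suc i" using \<open>j \<in> {1..<N}\<close> by (cases j) auto
    have "T \<inter> {..Suc i} = (if Suc i \<in> T then insert (Suc i) (T \<inter> {..i}) else T \<inter> {..i})"
      by (auto simp: atMost_Suc)
    then show ?thesis using that \<open>finite T\<close> by (simp add: l_def j)
  qed
  moreover have "ascents (mset l) = {j \<in> {1..<N}. l ! (j - 1) < l ! j}"
    unfolding ascents_def l by (simp add: l_def)
  ultimately have "ascents (mset l) = T"
    using assms by blast
  moreover have "size (mset l) = N" by (simp add: l_def)
  ultimately show thesis using that by blast
qed

text \<open>Uniqueness in Moebius inversion on subsets: by induction the proper subsets contribute
  nothing to the sum over \<open>Pow T\<close>.\<close>

lemma sum_Pow_zero_imp_zero:
  fixes c :: "'a set \<Rightarrow> rat"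
  assumes "\<And>T. T \<subseteq> A \<Longrightarrow> sum c (Pow T) = 0" and "T \<subseteq> A" "finite T"
  shows "c T = 0"
  using assms(3,2)
proof (induction T rule: finite_psubset_induct)
  case (psubset T)
  have "Pow T = insert T (Pow T - {T})" by auto
  then have "sum c (Pow T) = c T + sum c (Pow T - {T})"
    using psubset.hyps by (metis finite_Diff finite_Pow_iff Diff_iff singletonI sum.insert)
  moreover have "sum c (Pow T - {T}) = 0"
    using psubset by (intro sum.neutral) auto
  ultimately show ?case using assms(1)[OF psubset.prems] by simp
qed

text \<open>Turns expansion in the fundamental basis into summation over the subsets of ascent sets,
  ready for Moebius inversion.\<close>

lemma fundamental_expansion_iff:
  assumes "\<And>m. f m \<noteq> 0 \<Longrightarrow> size m = N"
  shows "(\<forall>m. f m = (\<Sum>S\<in>Pow {1..<N}. c S * fundamental N S m)) \<longleftrightarrow>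
    (\<forall>m. size m = N \<longrightarrow> f m = sum c (Pow (ascents m)))"
proof -
  have "(\<Sum>S\<in>Pow {1..<N}. c S * fundamental N S m) = (if size m = N then sum c (Pow (ascents m)) else 0)" for m
  proof (cases "size m = N")
    case True
    then have "(\<Sum>S\<in>Pow {1..<N}. c S * fundamental N S m) = (\<Sum>S\<in>Pow {1..<N}. if S \<subseteq> ascents m then c S else 0)"
      by (intro sum.cong) (auto simp: fundamental_eq)
    also have "\<dots> = sum c (Pow {1..<N} \<inter> {S. S \<subseteq> ascents m})"
      by (simp add: sum.inter_restrict)
    also have "Pow {1..<N} \<inter> {S. S \<subseteq> ascents m} = Pow (ascents m)"
      using True by (auto simp: ascents_def)
    finally show ?thesis using True by simp
  qed (simp add: fundamental_eq)
  then show ?thesis using assms by auto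
qed

text \<open>Justifies the definite description: Moebius inversion gives coordinates, and they are
  unique because every subset of \<open>{1..<N}\<close> is an ascent set.\<close>

lemma fundamental_coeffs_expansion:
  assumes f: "shift_invariant f" and deg: "\<And>m. f m \<noteq> 0 \<Longrightarrow> size m = N"
  shows "f m = (\<Sum>S\<in>Pow {1..<N}. fundamental_coeffs N f S * fundamental N S m)"
proof -
  let ?P = "\<lambda>c. (\<forall>S. \<not> S \<subseteq> {1..<N} \<longrightarrow> c S = 0) \<and>
             (\<forall>m. f m = (\<Sum>S\<in>Pow {1..<N}. c S * fundamental N S m))"
  \<comment> \<open>By shift invariance a coefficient depends only on the ascent set, so the choice
    of monomial is immaterial.\<close>
  define g where "g T = f (SOME m. size m = N \<and> ascents m = T)" for T
  have g: "f m = g (ascents m)" if "size m = N" for m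
  proof -
    have "size (SOME m'. size m' = N \<and> ascents m' = ascents m) = N \<and>
        ascents (SOME m'. size m' = N \<and> ascents m' = ascents m) = ascents m"
      using that by (intro someI[of "\<lambda>m'. size m' = N \<and> ascents m' = ascents m" m]) simp
    then show ?thesis
      unfolding g_def using shift_invariantD[OF f] that
      by (metis ascents_eq_imp_image)
  qed
  \<comment> \<open>The Moebius inverse of \<open>g\<close>, with the sign of |S| - |U| split into
    two factors as in \<open>inclusion_exclusion_symmetric\<close>.\<close>
  define c where "c S = (if S \<subseteq> {1..<N} then (- 1) ^ card S * (\<Sum>U\<in>Pow S. (- 1) ^ card U * g U) else 0)" for S
  have "sum c (Pow T) = g T" if T: "T \<subseteq> {1..<N}" for T
  proof -
    have "sum c (Pow T) = (\<Sum>S\<in>Pow T. (- 1) ^ card S * (\<Sum>U\<in>Pow S. (- 1) ^ card U * g U))"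
      using T by (intro sum.cong) (auto simp: c_def)
    also have "\<dots> = g T"
      using finite_subset[OF T] 
      by (intro inclusion_exclusion_symmetric[where f = g, symmetric]) auto
    finally show ?thesis .
  qed
  moreover have "ascents m \<subseteq> {1..<size m}" for m by (auto simp: ascents_def)
  ultimately have "\<forall>m. size m = N \<longrightarrow> f m = sum c (Pow (ascents m))"
    using g by metis
  then have "?P c"
    using fundamental_expansion_iff[of f N c] deg by (simp add: c_def)
  moreover have "c' = c" if "?P c'" for c'
  proof
    fix S
    show "c' S = c S"
    proof (cases "S \<subseteq> {1..<N}")
      case True
      have "(\<Sum>S\<in>Pow T. c' S - c S) = 0" if T: "T \<subseteq> {1..<N}" for T
      proof -
        obtain m where m: "size m = N" "ascents m = T" using exists_ascents_eq[OF T] .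
        have "f m = sum c (Pow T)" "f m = sum c' (Pow T)"
          using \<open>?P c\<close> \<open>?P c'\<close> m fundamental_expansion_iff[of f N] deg by metis+
        then show ?thesis by (simp add: sum_subtractf)
      qed
      then show ?thesis
        using sum_Pow_zero_imp_zero[of "{1..<N}" "\<lambda>S. c' S - c S" S] True finite_subset[OF True] by simp
    qed (use that \<open>?P c\<close> in simp)
  qed
  ultimately have "?P (fundamental_coeffs N f)"
    unfolding fundamental_coeffs_def by (rule theI)
  then show ?thesis by blast
qed

section \<open>Evaluation at ones\<close>

text \<open>Indexes the terms of \<open>fundamental N S\<close> that survive when the first n
  variables are set to 1 and the others to 0.\<close>

definition strict_lists :: "nat \<Rightarrow> nat set \<Rightarrow> nat \<Rightarrow> nat list set" where
  "strict_lists N S n =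
     {is. length is = N \<and> sorted is \<and> (\<forall>j\<in>S. is ! (j - 1) < is ! j) \<and> set is \<subseteq> {..<n}}"

lemma finite_strict_lists: "finite (strict_lists N S n)"
  by (rule finite_subset[OF _ finite_lists_length_eq[of "{..<n}" N]]) (auto simp: strict_lists_def)

text \<open>Split by whether the last entry is n. If not, sortedness bounds all entries below n; if
  so, it is removed, and a strict step at N becomes a smaller bound on the rest.\<close>

lemma strict_lists_Suc:
  assumes "S \<subseteq> {1..<Suc N}"
  shows "strict_lists (Suc N) S (Suc n) =
    strict_lists (Suc N) S n \<union>
    (\<lambda>xs. xs @ [n]) ` strict_lists N (S - {N}) (if N \<in> S then n else Suc n)" (is "?A = ?B \<union> ?C")
proof (intro equalityI subsetI)
  fix l assume l: "l \<in> ?A"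
  then have "length l = Suc N" by (simp add: strict_lists_def)
  then obtain xs x where lx: "l = xs @ [x]" "length xs = N"
    by (auto simp: length_Suc_conv_rev)
  show "l \<in> ?B \<union> ?C"
  proof (cases "x = n")
    case True
    have "xs ! (j - 1) < xs ! j" if "j \<in> S - {N}" for j
    proof -
      have "j < N" using that assms by auto
      then have "j < N" "j - 1 < N" by auto
      moreover have "l ! (j - 1) < l ! j" using l that by (simp add: strict_lists_def)
      ultimately show ?thesis using lx by (simp add: nth_append)
    qed
    moreover have "set xs \<subseteq> {..<n}" if "N \<in> S"
    proof
      fix y assume "y \<in> set xs"
      then obtain i where i: "i < N" "y = xs ! i" using lx by (auto simp: in_set_conv_nth)
      have "l ! (N - 1) < l ! N" using l that by (auto simp: strict_lists_def)
      then have "xs ! (N - 1) < n" using i lx True by (simp add: nth_append)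
      moreover have "xs ! i \<le> xs ! (N - 1)"
        using l lx i by (intro sorted_nth_mono) (auto simp: strict_lists_def sorted_append)
      ultimately show "y \<in> {..<n}" using i by simp
    qed
    ultimately have "xs \<in> strict_lists N (S - {N}) (if N \<in> S then n else Suc n)"
      using l lx by (auto simp: strict_lists_def sorted_append)
    then show ?thesis using lx True by blast
  next
    case False
    moreover have "\<forall>y\<in>set xs. y \<le> x" "x < Suc n"
      using l lx by (simp_all add: strict_lists_def sorted_append)
    ultimately have "set l \<subseteq> {..<n}" using lx by auto
    then show ?thesis using l by (simp add: strict_lists_def)
  qed
next
  fix l assume "l \<in> ?B \<union> ?C"
  then show "l \<in> ?A"
  proof
    assume "l \<in> ?B"
    then show ?thesis by (auto simp: strict_lists_def)
  next
    assume "l \<in> ?C"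
    then obtain xs where l: "l = xs @ [n]" and
      xs: "xs \<in> strict_lists N (S - {N}) (if N \<in> S then n else Suc n)" by blast
    have "l ! (j - 1) < l ! j" if "j \<in> S" for j
    proof (cases "j = N")
      case True
      then have "N - 1 < N" using that assms by auto
      then have "xs ! (N - 1) < n"
        using xs that True nth_mem[of "N - 1" xs] by (simp add: strict_lists_def subset_iff)
      then show ?thesis using xs True \<open>N - 1 < N\<close> by (simp add: l strict_lists_def nth_append)
    next
      case False
      then have "j < N" using that assms by auto
      then show ?thesis using xs that False by (auto simp: l strict_lists_def nth_append)
    qed
    then show ?thesis
      using xs by (auto simp: l strict_lists_def sorted_append split: if_splits)
  qed
qed

text \<open>Splitting by the last entry becomes Pascal's rule. If N lies in S, the bound and |S|
  both drop by one, so the count of the shortened lists has the same form in either case.\<close>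

lemma card_strict_lists:
  assumes "S \<subseteq> {1..<N}"
  shows "card (strict_lists N S (Suc n)) = (n + N - card S) choose N"
  using assms
proof (induction N arbitrary: S n)
  case 0
  then have "strict_lists 0 S (Suc n) = {[]}" by (auto simp: strict_lists_def)
  then show ?case by simp
next
  case (Suc N)
  have fin: "finite S" using Suc.prems finite_subset by blast
  have cS: "card S \<le> N" using card_mono[OF _ Suc.prems] by simp
  define B where "B n = strict_lists N (S - {N}) (if N \<in> S then n else Suc n)" for n
  have cB: "card (B n) = (n + N - card S) choose N" for n
  proof (cases "N \<in> S")
    case True
    have cS': "card (S - {N}) = card S - 1" "card S \<ge> 1"
      using True fin by (auto simp: Suc_le_eq card_gt_0_iff)
    have "N \<ge> 1" using True Suc.prems by auto
    show ?thesis
    proof (cases n)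
      case 0
      \<comment> \<open>No letter is left for a nonempty list, and the binomial vanishes because |S|
        is positive.\<close>
      then have "B n = {}" using True \<open>N \<ge> 1\<close> by (auto simp: B_def strict_lists_def)
      then show ?thesis using 0 cS' \<open>N \<ge> 1\<close> by (simp add: binomial_eq_0)
    next
      case (Suc n')
      have "S - {N} \<subseteq> {1..<N}" using Suc.prems \<open>S \<subseteq> {1..<Suc N}\<close> by auto
      then have "card (B n) = (n' + N - card (S - {N})) choose N"
        using True Suc \<open>\<And>S n. S \<subseteq> {1..<N} \<Longrightarrow> card (strict_lists N S (Suc n)) = (n + N - card S) choose N\<close>
        by (simp add: B_def)
      also have "n' + N - card (S - {N}) = n + N - card S" using Suc cS' by simp
      finally show ?thesis .
    qed
  next
    case False
    then have "S - {N} = S" "S \<subseteq> {1..<N}" using Suc.prems by (auto simp: less_Suc_eq)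
    then show ?thesis using False Suc.IH by (simp add: B_def)
  qed
  have step: "card (strict_lists (Suc N) S (Suc n)) = card (strict_lists (Suc N) S n) + card (B n)" for n
  proof -
    have "card (strict_lists (Suc N) S (Suc n)) = card (strict_lists (Suc N) S n) + card ((\<lambda>xs. xs @ [n]) ` B n)"
      unfolding strict_lists_Suc[OF Suc.prems] B_def
      by (rule card_Un_disjoint) (auto simp: finite_strict_lists, auto simp: strict_lists_def)
    then show ?thesis by (simp add: card_image inj_on_def)
  qed
  show ?case
  proof (induction n)
    case 0
    have "strict_lists (Suc N) S 0 = {}" by (auto simp: strict_lists_def)
    \<comment> \<open>With the single letter 0 both sides are 1 for empty S and 0 otherwise.\<close>
    then show ?case using step[of 0] cB[of 0] cS by (cases "card S") (simp_all add: binomial_eq_0)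
  next
    case (Suc n)
    then show ?case using step[of "Suc n"] cB[of "Suc n"] cS by (simp add: Suc_diff_le)
  qed
qed

text \<open>The value of \<open>f\<close> at \<open>k + 1\<close> ones, for \<open>f\<close> homogeneous of degree \<open>N\<close>.\<close>

definition ones_value :: "nat \<Rightarrow> series \<Rightarrow> nat \<Rightarrow> rat" where
  "ones_value N f k = sum f (multisets_of_size {..k} N)"

text \<open>Each coefficient counts index lists, so the value counts all of
  \<open>strict_lists N S (Suc k)\<close>, grouped by monomial.\<close>

lemma ones_value_fundamental:
  assumes "S \<subseteq> {1..<N}"
  shows "ones_value N (fundamental N S) k = of_nat ((k + N - card S) choose N)"
proof -
  let ?A = "strict_lists N S (Suc k)"
  have "fundamental N S m = of_nat (card {is \<in> ?A. mset is = m})" if "m \<in> multisets_of_size {..k} N" for m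
  proof -
    have "set_mset m \<subseteq> {..<Suc k}"
      using that by (simp add: multisets_of_size_def lessThan_Suc_atMost)
    then have "{is \<in> ?A. mset is = m} =
        {is. (length is = N \<and> sorted is \<and> (\<forall>j\<in>S. is ! (j - 1) < is ! j)) \<and> mset is = m}"
      unfolding strict_lists_def by auto
    then show ?thesis by (simp add: fundamental_def monomial_sum_def)
  qed
  then have "ones_value N (fundamental N S) k = (\<Sum>m\<in>multisets_of_size {..k} N. \<Sum>is | is \<in> ?A \<and> mset is = m. 1)"
    by (simp add: ones_value_def)
  also have "\<dots> = (\<Sum>is\<in>?A. 1)"
  proof (rule sum.group)
    show "mset ` ?A \<subseteq> multisets_of_size {..k} N"
      by (auto simp: multisets_of_size_def strict_lists_def lessThan_Suc_atMost)
  qed (auto intro: finite_strict_lists)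
  finally show ?thesis by (simp add: card_strict_lists[OF assms])
qed

lemma ones_value_complete_hom: "ones_value r (complete_hom r) k = of_nat ((k + r) choose r)"
  by (simp add: complete_hom_eq_fundamental ones_value_fundamental)

text \<open>Evaluation is multiplicative: pairs of monomials are regrouped by their product, and
  homogeneity confines the factors to degrees N and M.\<close>

lemma ones_value_series_mult:
  assumes "\<And>m. f m \<noteq> 0 \<Longrightarrow> size m = N" "\<And>m. g m \<noteq> 0 \<Longrightarrow> size m = M"
  shows "ones_value (N + M) (f \<star> g) k = ones_value N f k * ones_value M g k"
proof -
  let ?U = "multisets_of_size {..k}"
  have fin: "finite {p. fst p + snd p = m}" for m :: "nat multiset"
  proof (rule finite_subset)
    \<comment> \<open>Both factors of m use only variables of m and have size at most that of
      m.\<close>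
    let ?V = "\<Union>n\<le>size m. multisets_of_size (set_mset m) n"
    show "{p. fst p + snd p = m} \<subseteq> ?V \<times> ?V" by (auto simp: multisets_of_size_def)
    show "finite (?V \<times> ?V)" by (auto intro!: finite_multisets_of_size)
  qed
  have "ones_value (N + M) (f \<star> g) k = (\<Sum>m\<in>?U (N + M). \<Sum>p | fst p + snd p = m. f (fst p) * g (snd p))"
    by (simp add: ones_value_def series_mult_apply)
  also have "\<dots> = (\<Sum>m\<in>?U (N + M). \<Sum>p | p \<in> ?U N \<times> ?U M \<and> fst p + snd p = m. f (fst p) * g (snd p))"
  proof (rule sum.cong[OF refl], rule sum.mono_neutral_right)
    fix m assume m: "m \<in> ?U (N + M)"
    show "\<forall>p\<in>{p. fst p + snd p = m} - {p. p \<in> ?U N \<times> ?U M \<and> fst p + snd p = m}. f (fst p) * g (snd p) = 0"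
    proof (intro ballI, rule ccontr)
      fix p
      assume p: "p \<in> {p. fst p + snd p = m} - {p. p \<in> ?U N \<times> ?U M \<and> fst p + snd p = m}"
        and "f (fst p) * g (snd p) \<noteq> 0"
      then have "size (fst p) = N" "size (snd p) = M" using assms by auto
      moreover have "set_mset (fst p) \<union> set_mset (snd p) = set_mset m"
        using p by (simp flip: set_mset_union)
      ultimately have "p \<in> ?U N \<times> ?U M"
        using m by (auto simp: multisets_of_size_def mem_Times_iff)
      then show False using p by blast
    qed
  qed (auto simp: fin)
  also have "\<dots> = (\<Sum>p\<in>?U N \<times> ?U M. f (fst p) * g (snd p))"
  proof (rule sum.group)
    show "(\<lambda>p. fst p + snd p) ` (?U N \<times> ?U M) \<subseteq> ?U (N + M)"
      by (auto simp: multisets_of_size_def)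
  qed auto
  also have "\<dots> = ones_value N f k * ones_value M g k"
    by (simp add: ones_value_def sum_product sum.cartesian_product case_prod_beta)
  finally show ?thesis .
qed

text \<open>By linearity this is a statement about the basis: the value of
  \<open>fundamental N S\<close> at k + 1 ones is that of the monomial with d = N + 1 and a = |S| +
  1.\<close>

lemma represents_Phi:
  assumes "shift_invariant f" and "\<And>m. f m \<noteq> 0 \<Longrightarrow> size m = N"
  shows "represents (Suc N) (ones_value N f) (Phi N f)"
proof -
  let ?c = "fundamental_coeffs N f"
  have "ones_value N f = (\<lambda>k. \<Sum>S\<in>Pow {1..<N}. ?c S * of_nat ((k + Suc N - Suc (card S)) choose (Suc N - 1)))"
  proof
    fix k
    have "ones_value N f k = (\<Sum>m\<in>multisets_of_size {..k} N. \<Sum>S\<in>Pow {1..<N}. ?c S * fundamental N S m)"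
      unfolding ones_value_def by (intro sum.cong refl fundamental_coeffs_expansion assms)
    also have "\<dots> = (\<Sum>S\<in>Pow {1..<N}. ?c S * ones_value N (fundamental N S) k)"
      unfolding ones_value_def sum_distrib_left by (rule sum.swap)
    finally show "ones_value N f k = (\<Sum>S\<in>Pow {1..<N}. ?c S * of_nat ((k + Suc N - Suc (card S)) choose (Suc N - 1)))"
      by (simp add: ones_value_fundamental)
  qed
  moreover have "represents (Suc N)
      (\<lambda>k. \<Sum>S\<in>Pow {1..<N}. ?c S * of_nat ((k + Suc N - Suc (card S)) choose (Suc N - 1)))
      (\<Sum>S\<in>Pow {1..<N}. scale (?c S) (X ^ Suc (card S) * Y ^ (Suc N - Suc (card S))))"
  proof (intro represents_sum represents_scale represents_monomial)
    fix S assume "S \<in> Pow {1..<N}"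
    then show "Suc (card S) \<in> {1..Suc N}"
      using card_mono[of "{1..<N}" S] by auto
  qed
  ultimately show ?thesis
    by (simp add: Phi_def)
qed

theorem theorem11:
  fixes N r :: nat and f :: series
  assumes "f \<in> QSym N"
  shows "Phi (N + r) (complete_hom r \<star> f) = G r (Phi N f)"
proof -
  let ?h = "complete_hom r \<star> f"
  have f: "shift_invariant f" and deg: "\<And>m. f m \<noteq> 0 \<Longrightarrow> size m = N"
    using assms by (auto simp: QSym_def quasisymmetric_imp_shift_invariant)
  have deg_h: "complete_hom r m \<noteq> 0 \<Longrightarrow> size m = r" for m
    by (simp add: complete_hom_eq split: if_splits)
  have "shift_invariant ?h"
    by (intro shift_invariant_series_mult shift_invariant_complete_hom f)
  moreover have "size m = N + r" if "?h m \<noteq> 0" for m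
  proof -
    have "(\<Sum>p | fst p + snd p = m. complete_hom r (fst p) * f (snd p)) \<noteq> 0"
      using that by (simp add: series_mult_apply)
    then obtain p where "fst p + snd p = m" "complete_hom r (fst p) * f (snd p) \<noteq> 0"
      by (rule sum.not_neutral_contains_not_neutral) simp
    then show ?thesis using deg[of "snd p"] deg_h[of "fst p"] by auto
  qed
  ultimately have "represents (Suc (N + r)) (ones_value (N + r) ?h) (Phi (N + r) ?h)"
    by (rule represents_Phi)
  \<comment> \<open>Both polynomials of degree N + r + 1 thus represent the same values.\<close>
  moreover have "ones_value (N + r) ?h = (\<lambda>k. of_nat ((k + r) choose r) * ones_value N f k)"
    using ones_value_series_mult[OF deg_h deg] by (simp add: fun_eq_iff ones_value_complete_hom add.commute)
  moreover have "represents (Suc (N + r)) (\<lambda>k. of_nat ((k + r) choose r) * ones_value N f k) (G r (Phi N f))"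
    using represents_G[OF represents_Phi[OF f deg]] by simp
  ultimately show ?thesis by (simp add: represents_unique)
qed

end
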